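(* Let $(A,\cdot,[,],\alpha)$ be a Hom-Leibniz Poisson algebra and $(V,\lambda^l,\lambda^r,\rho^l,\rho^r,\phi)$ a representation of it. A linear map $T:V\to A$ is a relative Rota-Baxter operator on $(A,\cdot,[,],\alpha)$ with respect to $(V,\lambda^l,\lambda^r,\rho^l,\rho^r,\phi)$ if and only if the graph of $T$, $$G_r(T):=\{(T(v),v)\;:\;v\in V\},$$ is a subalgebra of the semi-direct product Hom-Leibniz Poisson algebra $A\oplus V$.
   Context: All vector spaces are over a field $\mathbb K$ of characteristic $0$; $gl(V)$ is the space of linear endomorphisms of $V$, and juxtaposition of operators is composition. A Hom-associative algebra $(A,\cdot,\alpha)$ is a vector space $A$ with a bilinear product and a linear map $\alpha:A\to A$ such that $\alpha(x\cdot y)=\alpha(x)\cdot\alpha(y)$ and $(x\cdot y)\cdot\alpha(z)=\alpha(x)\cdot(y\cdot z)$. A (right) Hom-Leibniz algebra $(A,[,],\alpha)$ is a vector space with a bilinear bracket and a linear map $\alpha$ such that $\alpha([x,y])=[\alpha(x),\alpha(y)]$ and $[[x,y],\alpha(z)]=[\alpha(x),[y,z]]+[[x,z],\alpha(y)]$. A Hom-Leibniz Poisson algebra $(A,\cdot,[,],\alpha)$ is such that $(A,\cdot,\alpha)$ is Hom-associative, $(A,[,],\alpha)$ is Hom-Leibniz, and $[x\cdot y,\alpha(z)]=\alpha(x)\cdot[y,z]+[x,z]\cdot\alpha(y)$ for all $x,y,z\in A$. A subalgebra of a Hom-Leibniz Poisson algebra is a linear subspace closed under both products and stable under the twisting map.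 A representation of a Hom-associative algebra $(A,\cdot,\alpha)$ is $(V,\lambda^l,\lambda^r,\phi)$ with $V$ a vector space, $\phi\in gl(V)$, and $\lambda^l,\lambda^r:A\to gl(V)$ linear such that for all $x,y\in A$: $\phi\lambda^l(x)=\lambda^l(\alpha(x))\phi$; $\phi\lambda^r(x)=\lambda^r(\alpha(x))\phi$; $\lambda^l(x\cdot y)\phi=\lambda^l(\alpha(x))\lambda^l(y)$; $\lambda^r(x\cdot y)\phi=\lambda^r(\alpha(y))\lambda^r(x)$; $\lambda^l(\alpha(x))\lambda^r(y)=\lambda^r(\alpha(y))\lambda^l(x)$. A representation of a Hom-Leibniz algebra $(A,[,],\alpha)$ is $(V,\rho^l,\rho^r,\phi)$ with $\phi\in gl(V)$ and $\rho^l,\rho^r:A\to gl(V)$ linear such that for all $x,y\in A$: $\rho^l(\alpha(x))\phi=\phi\rho^l(x)$; $\rho^r(\alpha(x))\phi=\phi\rho^r(x)$; $\rho^l([x,y])\phi=\rho^l(\alpha(x))\rho^l(y)+\rho^r(\alpha(y))\rho^l(x)$; $\rho^r(\alpha(y))\rho^l(x)=\rho^l(\alpha(x))\rho^r(y)+\rho^l([x,y])\phi$; $\rho^r(\alpha(y))\rho^r(x)=\rho^r([x,y])\phi+\rho^r(\alpha(x))\rho^r(y)$. A representation of a Hom-Leibniz Poisson algebra $(A,\cdot,[,],\alpha)$ is $(V,\lambda^l,\lambda^r,\rho^l,\rho^r,\phi)$ such that $(V,\lambda^l,\lambda^r,\phi)$ is a representation of $(A,\cdot,\alpha)$, $(V,\rho^l,\rho^r,\phi)$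 is a representation of $(A,[,],\alpha)$, and for all $x,y\in A$: $\rho^r(\alpha(y))\lambda^l(x)=\lambda^l(\alpha(x))\rho^r(y)+\lambda^l([x,y])\phi$; $\rho^r(\alpha(y))\lambda^r(x)=\lambda^r([x,y])\phi+\lambda^r(\alpha(x))\rho^r(y)$; $\rho^l(x\cdot y)\phi=\lambda^l(\alpha(x))\rho^l(y)+\lambda^r(\alpha(y))\rho^l(x)$. The semi-direct product is the Hom-Leibniz Poisson algebra $(A\oplus V,\ast,\{,\},\alpha\oplus\phi)$ with $(x+u)\ast(y+v)=x\cdot y+\lambda^l(x)v+\lambda^r(y)u$, $\{x+u,y+v\}=[x,y]+\rho^l(x)v+\rho^r(y)u$, $(\alpha\oplus\phi)(x+u)=\alpha(x)+\phi(u)$; $(x,u)$ and $x+u$ denote the same element. A relative Rota-Baxter operator on $(A,\cdot,[,],\alpha)$ with respect to $(V,\lambda^l,\lambda^r,\rho^l,\rho^r,\phi)$ is a linear map $T:V\to A$ with $T\phi=\alpha T$, $Tu\cdot Tv=T(\lambda^l(Tu)v+\lambda^r(Tv)u)$ and $[Tu,Tv]=T(\rho^l(Tu)v+\rho^r(Tv)u)$ for all $u,v\in V$. *)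

theory Defs
  imports "HOL-Analysis.Product_Vector"
begin

text \<open>
  Vector spaces are carried by whole types, with an explicit scalar multiplication over a field of
  characteristic 0, in the style of \<^locale>\<open>vector_space\<close>.
  \<open>bilinear_map\<close> serves two purposes: for a product \<open>A \<times> A \<rightarrow> A\<close>, and, read in curried form, for a
  linear map \<open>A \<rightarrow> gl(V)\<close> (each value is an endomorphism of \<open>V\<close>, and the map depends linearly on its
  argument, the vector space structure of \<open>gl(V)\<close> being pointwise).
\<close>

definition bilinear_map ::
  "('k::field \<Rightarrow> 'a::ab_group_add \<Rightarrow> 'a) \<Rightarrow> ('k \<Rightarrow> 'b::ab_group_add \<Rightarrow> 'b) \<Rightarrow>
   ('k \<Rightarrow> 'c::ab_group_add \<Rightarrow> 'c) \<Rightarrow> ('a \<Rightarrow> 'b \<Rightarrow> 'c) \<Rightarrow> bool" where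
  "bilinear_map s1 s2 s3 f \<longleftrightarrow>
     (\<forall>x. Vector_Spaces.linear s2 s3 (f x)) \<and> (\<forall>y. Vector_Spaces.linear s1 s3 (\<lambda>x. f x y))"

locale hom_associative_algebra = vector_space scale
  for scale :: "'k::field_char_0 \<Rightarrow> 'a::ab_group_add \<Rightarrow> 'a" +
  fixes mul :: "'a \<Rightarrow> 'a \<Rightarrow> 'a"
    and \<alpha> :: "'a \<Rightarrow> 'a"
  assumes mul_bilinear: "bilinear_map scale scale scale mul"
    and twist_linear: "Vector_Spaces.linear scale scale \<alpha>"
    and twist_mul: "\<alpha> (mul x y) = mul (\<alpha> x) (\<alpha> y)"
    and hom_assoc: "mul (mul x y) (\<alpha> z) = mul (\<alpha> x) (mul y z)"

locale hom_leibniz_algebra = vector_space scale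
  for scale :: "'k::field_char_0 \<Rightarrow> 'a::ab_group_add \<Rightarrow> 'a" +
  fixes br :: "'a \<Rightarrow> 'a \<Rightarrow> 'a"
    and \<alpha> :: "'a \<Rightarrow> 'a"
  assumes br_bilinear: "bilinear_map scale scale scale br"
    and br_twist_linear: "Vector_Spaces.linear scale scale \<alpha>"
    and twist_br: "\<alpha> (br x y) = br (\<alpha> x) (\<alpha> y)"
    and hom_leibniz: "br (br x y) (\<alpha> z) = br (\<alpha> x) (br y z) + br (br x z) (\<alpha> y)"

locale hom_leibniz_poisson_algebra =
  hom_associative_algebra scale mul \<alpha> + hom_leibniz_algebra scale br \<alpha>
  for scale :: "'k::field_char_0 \<Rightarrow> 'a::ab_group_add \<Rightarrow> 'a"
    and mul br :: "'a \<Rightarrow> 'a \<Rightarrow> 'a"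
    and \<alpha> :: "'a \<Rightarrow> 'a" +
  assumes hom_leibniz_poisson: "br (mul x y) (\<alpha> z) = mul (\<alpha> x) (br y z) + mul (br x z) (\<alpha> y)"

locale hom_leibniz_poisson_subalgebra = hom_leibniz_poisson_algebra scale mul br \<alpha>
  for scale :: "'k::field_char_0 \<Rightarrow> 'a::ab_group_add \<Rightarrow> 'a"
    and mul br :: "'a \<Rightarrow> 'a \<Rightarrow> 'a"
    and \<alpha> :: "'a \<Rightarrow> 'a" +
  fixes S :: "'a set"
  assumes subspace: "subspace S"
    and mul_closed: "x \<in> S \<Longrightarrow> y \<in> S \<Longrightarrow> mul x y \<in> S"
    and br_closed: "x \<in> S \<Longrightarrow> y \<in> S \<Longrightarrow> br x y \<in> S"
    and twist_closed: "x \<in> S \<Longrightarrow> \<alpha> x \<in> S"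

locale hom_associative_representation =
  hom_associative_algebra scale mul \<alpha> + V: vector_space scaleV
  for scale :: "'k::field_char_0 \<Rightarrow> 'a::ab_group_add \<Rightarrow> 'a"
    and mul :: "'a \<Rightarrow> 'a \<Rightarrow> 'a"
    and \<alpha> :: "'a \<Rightarrow> 'a"
    and scaleV :: "'k \<Rightarrow> 'v::ab_group_add \<Rightarrow> 'v" +
  fixes \<Lambda>l \<Lambda>r :: "'a \<Rightarrow> 'v \<Rightarrow> 'v"
    and \<phi> :: "'v \<Rightarrow> 'v"
  assumes phi_linear: "Vector_Spaces.linear scaleV scaleV \<phi>"
    and ll_linear: "bilinear_map scale scaleV scaleV \<Lambda>l"
    and lr_linear: "bilinear_map scale scaleV scaleV \<Lambda>r"
    and phi_ll: "\<phi> \<circ> \<Lambda>l x = \<Lambda>l (\<alpha> x) \<circ> \<phi>"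
    and phi_lr: "\<phi> \<circ> \<Lambda>r x = \<Lambda>r (\<alpha> x) \<circ> \<phi>"
    and ll_mul: "\<Lambda>l (mul x y) \<circ> \<phi> = \<Lambda>l (\<alpha> x) \<circ> \<Lambda>l y"
    and lr_mul: "\<Lambda>r (mul x y) \<circ> \<phi> = \<Lambda>r (\<alpha> y) \<circ> \<Lambda>r x"
    and ll_lr: "\<Lambda>l (\<alpha> x) \<circ> \<Lambda>r y = \<Lambda>r (\<alpha> y) \<circ> \<Lambda>l x"

text \<open>Sums of endomorphisms are written pointwise, as \<open>'v \<Rightarrow> 'v\<close> has no additive structure here.\<close>

locale hom_leibniz_representation =
  hom_leibniz_algebra scale br \<alpha> + V: vector_space scaleV
  for scale :: "'k::field_char_0 \<Rightarrow> 'a::ab_group_add \<Rightarrow> 'a"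
    and br :: "'a \<Rightarrow> 'a \<Rightarrow> 'a"
    and \<alpha> :: "'a \<Rightarrow> 'a"
    and scaleV :: "'k \<Rightarrow> 'v::ab_group_add \<Rightarrow> 'v" +
  fixes \<rho>l \<rho>r :: "'a \<Rightarrow> 'v \<Rightarrow> 'v"
    and \<phi> :: "'v \<Rightarrow> 'v"
  assumes br_phi_linear: "Vector_Spaces.linear scaleV scaleV \<phi>"
    and rl_linear: "bilinear_map scale scaleV scaleV \<rho>l"
    and rr_linear: "bilinear_map scale scaleV scaleV \<rho>r"
    and phi_rl: "\<rho>l (\<alpha> x) \<circ> \<phi> = \<phi> \<circ> \<rho>l x"
    and phi_rr: "\<rho>r (\<alpha> x) \<circ> \<phi> = \<phi> \<circ> \<rho>r x"
    and rl_br: "\<rho>l (br x y) (\<phi> v) = \<rho>l (\<alpha> x) (\<rho>l y v) + \<rho>r (\<alpha> y) (\<rho>l x v)"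
    and rr_rl: "\<rho>r (\<alpha> y) (\<rho>l x v) = \<rho>l (\<alpha> x) (\<rho>r y v) + \<rho>l (br x y) (\<phi> v)"
    and rr_rr: "\<rho>r (\<alpha> y) (\<rho>r x v) = \<rho>r (br x y) (\<phi> v) + \<rho>r (\<alpha> x) (\<rho>r y v)"

locale hom_leibniz_poisson_representation =
  hom_leibniz_poisson_algebra scale mul br \<alpha> +
  hom_associative_representation scale mul \<alpha> scaleV \<Lambda>l \<Lambda>r \<phi> +
  hom_leibniz_representation scale br \<alpha> scaleV \<rho>l \<rho>r \<phi>
  for scale :: "'k::field_char_0 \<Rightarrow> 'a::ab_group_add \<Rightarrow> 'a"
    and mul br :: "'a \<Rightarrow> 'a \<Rightarrow> 'a"
    and \<alpha> :: "'a \<Rightarrow> 'a"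
    and scaleV :: "'k \<Rightarrow> 'v::ab_group_add \<Rightarrow> 'v"
    and \<Lambda>l \<Lambda>r \<rho>l \<rho>r :: "'a \<Rightarrow> 'v \<Rightarrow> 'v"
    and \<phi> :: "'v \<Rightarrow> 'v" +
  assumes rr_ll: "\<rho>r (\<alpha> y) (\<Lambda>l x v) = \<Lambda>l (\<alpha> x) (\<rho>r y v) + \<Lambda>l (br x y) (\<phi> v)"
    and rr_lr: "\<rho>r (\<alpha> y) (\<Lambda>r x v) = \<Lambda>r (br x y) (\<phi> v) + \<Lambda>r (\<alpha> x) (\<rho>r y v)"
    and rl_mul: "\<rho>l (mul x y) (\<phi> v) = \<Lambda>l (\<alpha> x) (\<rho>l y v) + \<Lambda>r (\<alpha> y) (\<rho>l x v)"

text \<open>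
  The semi-direct product lives on \<open>'a \<times> 'v\<close>, with scalar multiplication
  \<^const>\<open>module_prod.scale\<close> and twisting map \<open>map_prod \<alpha> \<phi>\<close>. Both of its products are instances of:
\<close>

definition semidirect_op ::
  "('a \<Rightarrow> 'a \<Rightarrow> 'a) \<Rightarrow> ('a \<Rightarrow> 'v \<Rightarrow> 'v) \<Rightarrow> ('a \<Rightarrow> 'v \<Rightarrow> 'v) \<Rightarrow> 'a \<times> 'v \<Rightarrow> 'a \<times> 'v \<Rightarrow> 'a \<times> 'v::plus" where
  "semidirect_op f l r = (\<lambda>(x, u) (y, v). (f x y, l x v + r y u))"

lemma bilinear_map_semidirect_op:
  assumes "bilinear_map s s s f" "bilinear_map s t t l" "bilinear_map s t t r"
  shows "bilinear_map (module_prod.scale s t) (module_prod.scale s t) (module_prod.scale s t)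
           (semidirect_op f l r)"
proof -
  have s: "vector_space s" and t: "vector_space t"
    using assms(1,2) by (auto simp: bilinear_map_def Vector_Spaces.linear_iff)
  interpret vector_space_prod s t
    using s t by (simp add: vector_space_prod_def vector_space_pair_def)
  show ?thesis
    using assms
    by (auto simp: bilinear_map_def Vector_Spaces.linear_iff semidirect_op_def scale_def
        vs1.scale_right_distrib vs2.scale_right_distrib p.vector_space_axioms)
qed

theorem (in hom_leibniz_poisson_representation) semidirect_product:
  "hom_leibniz_poisson_algebra (module_prod.scale scale scaleV)
     (semidirect_op mul \<Lambda>l \<Lambda>r) (semidirect_op br \<rho>l \<rho>r) (map_prod \<alpha> \<phi>)"
proof -
  interpret P: vector_space_prod scale scaleV
    by unfold_locales
  note bil = mul_bilinear br_bilinear ll_linear lr_linear rl_linear rr_linear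
  note add = bil[unfolded bilinear_map_def Vector_Spaces.linear_iff]
  note cs = phi_ll[THEN fun_cong, simplified] phi_lr[THEN fun_cong, simplified]
    phi_rl[THEN fun_cong, simplified, symmetric] phi_rr[THEN fun_cong, simplified, symmetric]
    ll_mul[THEN fun_cong, simplified] lr_mul[THEN fun_cong, simplified]
    ll_lr[THEN fun_cong, simplified]
  have lin: "Vector_Spaces.linear P.scale P.scale (map_prod \<alpha> \<phi>)"
    using twist_linear phi_linear
    by (auto simp: Vector_Spaces.linear_iff P.p.vector_space_axioms P.scale_def prod_eq_iff)
  have phi_add: "\<phi> (u + v) = \<phi> u + \<phi> v" for u v
    using phi_linear by (simp add: Vector_Spaces.linear_iff)
  show ?thesis
  proof (intro hom_leibniz_poisson_algebra.intro hom_associative_algebra.intro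
      hom_leibniz_algebra.intro hom_associative_algebra_axioms.intro
      hom_leibniz_algebra_axioms.intro hom_leibniz_poisson_algebra_axioms.intro
      P.p.vector_space_axioms lin)
    show "bilinear_map P.scale P.scale P.scale (semidirect_op mul \<Lambda>l \<Lambda>r)"
      "bilinear_map P.scale P.scale P.scale (semidirect_op br \<rho>l \<rho>r)"
      by (rule bilinear_map_semidirect_op; fact bil)+
  next
    fix x y z :: "'a \<times> 'v"
    let ?m = "semidirect_op mul \<Lambda>l \<Lambda>r" and ?b = "semidirect_op br \<rho>l \<rho>r" and ?t = "map_prod \<alpha> \<phi>"
    obtain x1 x2 y1 y2 z1 z2 where xyz: "x = (x1, x2)" "y = (y1, y2)" "z = (z1, z2)"
      by (metis surj_pair)
    show "?t (?m x y) = ?m (?t x) (?t y)" "?t (?b x y) = ?b (?t x) (?t y)"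
      by (simp_all add: xyz semidirect_op_def twist_mul twist_br cs phi_add)
    show "?m (?m x y) (?t z) = ?m (?t x) (?m y z)"
      by (simp add: xyz semidirect_op_def hom_assoc cs add)
    show "?b (?b x y) (?t z) = ?b (?t x) (?b y z) + ?b (?b x z) (?t y)"
      using hom_leibniz[of x1 y1 z1] rl_br[of x1 y1 z2] rr_rl[of z1 x1 y2] rr_rr[of z1 y1 x2]
      by (simp add: xyz semidirect_op_def add)
    show "?b (?m x y) (?t z) = ?m (?t x) (?b y z) + ?m (?b x z) (?t y)"
      using hom_leibniz_poisson[of x1 y1 z1] rl_mul[of x1 y1 z2] rr_ll[of z1 x1 y2]
        rr_lr[of z1 y1 x2]
      by (simp add: xyz semidirect_op_def add)
  qed
qed

locale relative_rota_baxter_operator =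
  hom_leibniz_poisson_representation scale mul br \<alpha> scaleV \<Lambda>l \<Lambda>r \<rho>l \<rho>r \<phi>
  for scale :: "'k::field_char_0 \<Rightarrow> 'a::ab_group_add \<Rightarrow> 'a"
    and mul br :: "'a \<Rightarrow> 'a \<Rightarrow> 'a"
    and \<alpha> :: "'a \<Rightarrow> 'a"
    and scaleV :: "'k \<Rightarrow> 'v::ab_group_add \<Rightarrow> 'v"
    and \<Lambda>l \<Lambda>r \<rho>l \<rho>r :: "'a \<Rightarrow> 'v \<Rightarrow> 'v"
    and \<phi> :: "'v \<Rightarrow> 'v" +
  fixes T :: "'v \<Rightarrow> 'a"
  assumes T_linear: "Vector_Spaces.linear scaleV scale T"
    and T_phi: "T \<circ> \<phi> = \<alpha> \<circ> T"
    and T_mul: "mul (T u) (T v) = T (\<Lambda>l (T u) v + \<Lambda>r (T v) u)"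
    and T_br: "br (T u) (T v) = T (\<rho>l (T u) v + \<rho>r (T v) u)"

definition Gr :: "('v \<Rightarrow> 'a) \<Rightarrow> ('a \<times> 'v) set" where
  "Gr T = {(T v, v) | v. v \<in> UNIV}"

end

theory Submission
  imports Defs
begin

text \<open>A pair lies on the graph exactly when its \<open>A\<close>-component is \<open>T\<close>
  of its \<open>V\<close>-component. Applying an operation of the semi-direct product to graph
  points and imposing this equation therefore gives one axiom of a relative Rota-Baxter operator:
  each product gives its own identity (\<open>semidirect_op_closed_Gr_iff\<close>), the twist gives
  \<open>T \<circ> \<phi> = \<alpha> \<circ> T\<close> (\<open>map_prod_closed_Gr_iff\<close>).
  Linearity of \<open>T\<close> makes the graph a subspace (\<open>subspace_Gr\<close>).\<close>

lemma mem_Gr_iff: "(a, v) \<in> Gr T \<longleftrightarrow> a = T v"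
  by (auto simp: Gr_def)

lemma subspace_Gr:
  assumes "Vector_Spaces.linear t s T"
  shows "module.subspace (module_prod.scale s t) (Gr T)"
proof -
  \<comment> \<open>Linearity of \<open>T\<close> already contains that \<open>t\<close> and
    \<open>s\<close> are vector space structures.\<close>
  interpret vector_space_prod s t
    using assms by (simp add: Vector_Spaces.linear_iff vector_space_prod_def vector_space_pair_def)
  interpret T: Vector_Spaces.linear t s T
    by (fact assms)
  show ?thesis
    by (auto simp: p.subspace_def scale_def mem_Gr_iff zero_prod_def T.zero T.add T.scale)
qed

text \<open>The points \<open>(T u, u)\<close> and \<open>(T v, v)\<close> multiply to
  \<open>(f (T u) (T v), l (T u) v + r (T v) u)\<close>. Keeping \<open>f\<close>, \<open>l\<close>,
  \<open>r\<close> arbitrary lets one argument serve both the associative product and the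
  bracket.\<close>

lemma semidirect_op_closed_Gr_iff:
  "(\<forall>x\<in>Gr T. \<forall>y\<in>Gr T. semidirect_op f l r x y \<in> Gr T) \<longleftrightarrow>
    (\<forall>u v. f (T u) (T v) = T (l (T u) v + r (T v) u))"
  by (auto simp: Gr_def semidirect_op_def)

lemma map_prod_closed_Gr_iff:
  "(\<forall>x\<in>Gr T. map_prod \<alpha> \<phi> x \<in> Gr T) \<longleftrightarrow> T \<circ> \<phi> = \<alpha> \<circ> T"
  by (auto simp: Gr_def fun_eq_iff)

theorem proposition4p12:
  fixes scale :: "'k::field_char_0 \<Rightarrow> 'a::ab_group_add \<Rightarrow> 'a"
    and mul br :: "'a \<Rightarrow> 'a \<Rightarrow> 'a"
    and \<alpha> :: "'a \<Rightarrow> 'a"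
    and scaleV :: "'k \<Rightarrow> 'v::ab_group_add \<Rightarrow> 'v"
    and \<Lambda>l \<Lambda>r \<rho>l \<rho>r :: "'a \<Rightarrow> 'v \<Rightarrow> 'v"
    and \<phi> :: "'v \<Rightarrow> 'v"
    and T :: "'v \<Rightarrow> 'a"
  assumes "hom_leibniz_poisson_algebra scale mul br \<alpha>"
    and "hom_leibniz_poisson_representation scale mul br \<alpha> scaleV \<Lambda>l \<Lambda>r \<rho>l \<rho>r \<phi>"
    and "Vector_Spaces.linear scaleV scale T"
  shows "relative_rota_baxter_operator scale mul br \<alpha> scaleV \<Lambda>l \<Lambda>r \<rho>l \<rho>r \<phi> T \<longleftrightarrow>
    hom_leibniz_poisson_subalgebra (module_prod.scale scale scaleV)
      (semidirect_op mul \<Lambda>l \<Lambda>r) (semidirect_op br \<rho>l \<rho>r) (map_prod \<alpha> \<phi>) (Gr T)"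
proof -
  interpret hom_leibniz_poisson_representation scale mul br \<alpha> scaleV \<Lambda>l \<Lambda>r \<rho>l \<rho>r \<phi>
    by (fact assms(2))
  show ?thesis
    using semidirect_op_closed_Gr_iff[of T mul \<Lambda>l \<Lambda>r] semidirect_op_closed_Gr_iff[of T br \<rho>l \<rho>r]
      map_prod_closed_Gr_iff[of T \<alpha> \<phi>]
    \<comment> \<open>The representation, the ambient algebra (\<open>semidirect_product\<close>),
      linearity and the subspace condition all hold outright, so only the three closure equivalences
      remain to be matched.\<close>
    by (simp add: relative_rota_baxter_operator_def relative_rota_baxter_operator_axioms_def
        hom_leibniz_poisson_subalgebra_def hom_leibniz_poisson_subalgebra_axioms_def
        hom_leibniz_poisson_representation_axioms semidirect_product subspace_Gr assms Ball_def) blast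
qed

end
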